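(* For every integer $d\geq 2$, one has $e_r^*(d)\leq d-2$.
   Context: All polynomials have integer coefficients. For an integer polynomial $P(x)$ of degree $d\ge 2$, let $\mathrm{H}(P)$ denote its naïve height, i.e. the maximum of the absolute values of its coefficients. If $P$ has at least two distinct complex roots, its root separation is $$\mathrm{sep}(P):=\min_{\substack{P(\alpha)=P(\beta)=0,\\ \alpha\neq\beta}}|\alpha-\beta|,$$ where the minimum is over pairs of distinct complex roots of $P$. The quantity $e(P)$ is defined (when $\mathrm{H}(P)>1$) by $\mathrm{sep}(P)=\mathrm{H}(P)^{-e(P)}$, that is, $e(P)=-\log \mathrm{sep}(P)/\log \mathrm{H}(P)$. For $d\ge 2$, set $$e_r^*(d):=\limsup_{\deg(P)=d,\ \mathrm{H}(P)\to+\infty} e(P)=\lim_{H\to+\infty}\ \sup\{e(P): \deg P=d,\ \mathrm{H}(P)\ge H\},$$ where $P$ ranges over the monic integer polynomials of degree $d$ that are reducible over $\mathbb{Q}$ and have at least two distinct complex roots (the roots are not required to be simple). *)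

theory Defs
  imports Complex_Main "HOL-Library.Extended_Real" "HOL-Library.Liminf_Limsup"
    "HOL-Computational_Algebra.Computational_Algebra"
begin

definition naive_height :: "int poly \<Rightarrow> int" where
  "naive_height P = Max ((\<lambda>i. \<bar>coeff P i\<bar>) ` {..degree P})"

definition complex_roots :: "int poly \<Rightarrow> complex set" where
  "complex_roots P = {z. poly (map_poly of_int P) z = 0}"

text \<open>Meaningful only for nonzero \<open>P\<close> with at least two distinct complex roots;
  then the set below is finite and nonempty.\<close>

definition root_sep :: "int poly \<Rightarrow> real" where
  "root_sep P =
     Min {cmod (\<alpha> - \<beta>) |\<alpha> \<beta>. \<alpha> \<in> complex_roots P \<and> \<beta> \<in> complex_roots P \<and> \<alpha> \<noteq> \<beta>}"

text \<open>Meaningful only if, in addition, \<open>naive_height P > 1\<close>.\<close>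

definition sep_exponent :: "int poly \<Rightarrow> real" where
  "sep_exponent P = - ln (root_sep P) / ln (real_of_int (naive_height P))"

text \<open>For a polynomial of degree at least 2, being reducible over the rationals is the same as not
  being \<^const>\<open>irreducible\<close> in the ring of rational polynomials, as it is neither zero nor a unit.\<close>

definition monic_reducible :: "nat \<Rightarrow> int poly set" where
  "monic_reducible d =
     {P. degree P = d \<and> lead_coeff P = 1 \<and>
         \<not> irreducible (map_poly of_int P :: rat poly) \<and>
         (\<exists>\<alpha>\<in>complex_roots P. \<exists>\<beta>\<in>complex_roots P. \<alpha> \<noteq> \<beta>)}"

text \<open>The filter describes \<open>naive_height P\<close> tending to infinity with \<open>P\<close> ranging over
  \<open>monic_reducible d\<close>. The limsup is taken in the extended reals.\<close>

definition e_r_star :: "nat \<Rightarrow> ereal" where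
  "e_r_star d =
     Limsup (inf (filtercomap naive_height at_top) (principal (monic_reducible d)))
       (\<lambda>P. ereal (sep_exponent P))"

lemma e_r_star_eq_INF:
  "e_r_star d =
     (INF H::int. SUP P\<in>{P \<in> monic_reducible d. naive_height P \<ge> H}. ereal (sep_exponent P))"
    (is "_ = (INF H. ?S H)")
proof (rule antisym)
  show "e_r_star d \<le> (INF H. ?S H)"
  proof (rule INF_greatest)
    fix H :: int
    have "eventually (\<lambda>P. P \<in> monic_reducible d \<and> naive_height P \<ge> H)
            (inf (filtercomap naive_height at_top) (principal (monic_reducible d)))"
      unfolding eventually_inf_principal
      by (rule eventually_filtercomapI[OF eventually_ge_at_top[of H], THEN eventually_mono]) auto
    then show "e_r_star d \<le> ?S H"
      unfolding e_r_star_def by (intro Limsup_bounded) (auto elim!: eventually_mono intro: SUP_upper)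
  qed
next
  show "(INF H. ?S H) \<le> e_r_star d"
    unfolding e_r_star_def Limsup_def
  proof (rule INF_greatest)
    fix Q assume "Q \<in> {Q. eventually Q
      (inf (filtercomap naive_height at_top) (principal (monic_reducible d)))}"
    then obtain H where "\<And>P. naive_height P \<ge> H \<Longrightarrow> P \<in> monic_reducible d \<Longrightarrow> Q P"
      by (auto simp: eventually_inf_principal eventually_filtercomap eventually_at_top_linorder)
    then have "?S H \<le> (SUP P\<in>Collect Q. ereal (sep_exponent P))"
      by (intro SUP_subset_mono) auto
    then show "(INF H. ?S H) \<le> (SUP P\<in>Collect Q. ereal (sep_exponent P))"
      by (meson INF_lower2 UNIV_I)
  qed
qed

lemma e_r_star_limit:
  "((\<lambda>H::int. SUP P\<in>{P \<in> monic_reducible d. naive_height P \<ge> H}. ereal (sep_exponent P))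
      \<longlongrightarrow> e_r_star d) at_top"
    (is "(?S \<longlongrightarrow> _) _")
proof (rule order_tendstoI)
  have anti: "?S H' \<le> ?S H" if "H \<le> H'" for H H'
    using that by (intro SUP_subset_mono) auto
  fix a
  show "eventually (\<lambda>H. a < ?S H) at_top" if "a < e_r_star d"
    using that unfolding e_r_star_eq_INF
    by (intro always_eventually allI) (meson INF_lower UNIV_I less_le_trans)
  show "eventually (\<lambda>H. ?S H < a) at_top" if "e_r_star d < a"
  proof -
    from that obtain H where "?S H < a" unfolding e_r_star_eq_INF by (auto simp: INF_less_iff)
    then show ?thesis
      using anti by (intro eventually_mono[OF eventually_ge_at_top[of H]]) (meson le_less_trans)
  qed
qed

end

theory Submission
  imports "Berlekamp_Zassenhaus.Factor_Bound" Defs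
begin

text \<open>Let \<open>\<alpha> \<noteq> \<beta>\<close> be roots of \<open>P\<close> at minimal distance and let \<open>Q\<close>, \<open>R\<close> be monic irreducible integer
  factors of \<open>P\<close> with \<open>Q(\<alpha>) = 0\<close> and \<open>R(\<beta>) = 0\<close>. If \<open>\<beta>\<close> is a root of \<open>Q\<close> too, then
  \<open>\<Prod> Q'(a)\<close> over the roots \<open>a\<close> of \<open>Q\<close> is a nonzero integer, so the product of \<open>\<bar>a - b\<bar>\<close> over ordered
  pairs of distinct roots of \<open>Q\<close> is at least 1. If it is not, \<open>\<Prod> R(a)\<close> is a nonzero integer and the
  product of \<open>\<bar>a - b\<bar>\<close> over roots \<open>a\<close> of \<open>Q\<close> and \<open>b\<close> of \<open>R\<close> is at least 1. All differences but \<open>\<bar>\<alpha> - \<beta>\<bar>\<close> are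
  estimated by \<open>\<bar>a - b\<bar> \<le> 2 max(1,\<bar>a\<bar>) max(1,\<bar>b\<bar>)\<close>. Since \<open>deg Q \<le> d - 1\<close> by reducibility in the first case,
  and \<open>deg Q + deg R \<le> d\<close> in the second, no root has to be used more than \<open>d - 2\<close> times per factor
  \<open>\<bar>\<alpha> - \<beta>\<bar>\<close>, so \<open>\<bar>\<alpha> - \<beta>\<bar>\<close> is bounded below by a constant times \<open>M(P)\<close> to the power \<open>-(d - 2)\<close>. Landau's
  inequality bounds the Mahler measure \<open>M(P)\<close> by a multiple of the height.\<close>

subsection \<open>Irreducible integer polynomials and their roots\<close>

text \<open>Let \<open>G\<close> have least degree among the nonzero integer polynomials vanishing
  at \<open>a\<close>. By minimality pseudo-division by \<open>G\<close> leaves no remainder, so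
  \<open>G\<close> divides a nonzero constant multiple of any polynomial vanishing at
  \<open>a\<close>. Primality of \<open>Q\<close> then removes the constants: first \<open>Q\<close>
  divides \<open>G\<close>, hence a multiple of \<open>F\<close>, hence \<open>F\<close>.\<close>

lemma irreducible_dvd_if_common_root:
  fixes Q F :: "int poly"
  assumes irr: "irreducible Q" and Qa: "a \<in> complex_roots Q" and Fa: "a \<in> complex_roots F"
  shows "Q dvd F"
proof -
  have Q0: "Q \<noteq> 0" using irr by auto
  define good where "good = (\<lambda>G :: int poly. G \<noteq> 0 \<and> a \<in> complex_roots G)"
  have "good Q" using Q0 Qa by (simp add: good_def)
  then obtain G where G: "good G" and min: "\<And>G'. good G' \<Longrightarrow> degree G \<le> degree G'"
    using ex_has_least_nat[of good Q degree] by auto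
  have G0: "G \<noteq> 0" and Ga: "a \<in> complex_roots G" using G by (auto simp: good_def)
  have nonconst: "degree H > 0" if "H \<noteq> 0" "a \<in> complex_roots H" for H
  proof (rule ccontr)
    assume "\<not> degree H > 0"
    then obtain c where "H = [:c:]" by (auto elim: degree_eq_zeroE)
    then show False using that by (auto simp: complex_roots_def)
  qed
  have pseudo_dvd: "\<exists>c S. c \<noteq> 0 \<and> smult c H = G * S" if H: "a \<in> complex_roots H" for H
  proof -
    from pseudo_mod[OF G0, of H] obtain c S where
      c: "c \<noteq> 0" "smult c H = G * S + pseudo_mod H G"
      and deg: "pseudo_mod H G = 0 \<or> degree (pseudo_mod H G) < degree G"
      by auto
    have "a \<in> complex_roots (pseudo_mod H G)"
      using arg_cong[OF c(2), of "\<lambda>p. poly (of_int_poly p) a"] H Ga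
      by (simp add: complex_roots_def hom_distribs)
    then have "pseudo_mod H G = 0"
      using deg min[of "pseudo_mod H G"] by (force simp: good_def)
    then show ?thesis using c by auto
  qed
  have prime: "prime_elem Q" using irr by (rule irreducible_imp_prime_elem)
  have "Q dvd G"
  proof -
    obtain c S where c: "c \<noteq> 0" "smult c Q = G * S" using pseudo_dvd[OF Qa] by auto
    have "Q dvd G * S" by (metis c(2) dvd_refl dvd_smult)
    \<comment> \<open>Cancelling \<open>Q\<close> would exhibit \<open>G\<close> as a divisor of the
      nonzero constant \<open>c\<close>, although \<open>G\<close> has a root.\<close>
    moreover have "\<not> Q dvd S"
    proof
      assume "Q dvd S"
      then obtain T where "S = Q * T" by auto
      with c have "Q * [:c:] = Q * (G * T)" by (simp add: ac_simps)
      then have GT: "[:c:] = G * T" using Q0 mult_left_cancel by blast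
      then have "degree (G * T) = 0" by (metis degree_pCons_0)
      moreover have "T \<noteq> 0" using GT c by auto
      ultimately show False using nonconst[OF G0 Ga] G0 by (simp add: degree_mult_eq)
    qed
    ultimately show ?thesis using prime by (simp add: prime_elem_dvd_mult_iff)
  qed
  moreover obtain c S where c: "c \<noteq> 0" "smult c F = G * S" using pseudo_dvd[OF Fa] by auto
  ultimately have "Q dvd [:c:] * F" by simp
  moreover have "\<not> Q dvd [:c:]"
    using nonconst[OF Q0 Qa] c(1) dvd_imp_degree_le[of Q "[:c:]"] by auto
  ultimately show ?thesis using prime by (simp only: prime_elem_dvd_mult_iff) simp
qed

text \<open>A root of a product is a root of a factor, so induction over a prime factorisation finds
  \<open>Q\<close>. Its leading coefficient divides 1, so \<open>Q\<close> or \<open>- Q\<close> is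
  monic.\<close>

lemma monic_irreducible_factor_with_root:
  assumes P: "lead_coeff P = 1" and a: "a \<in> complex_roots P"
  obtains Q where "irreducible Q" "lead_coeff Q = 1" "Q dvd P" "a \<in> complex_roots Q"
proof -
  have "P \<noteq> 0 \<longrightarrow> a \<in> complex_roots P \<longrightarrow>
    (\<exists>Q. irreducible Q \<and> Q dvd P \<and> a \<in> complex_roots Q)"
  proof (induction P rule: prime_divisors_induct)
    case (unit x)
    then show ?case by (auto simp: complex_roots_def is_unit_poly_iff)
  next
    case (factor p x)
    have "a \<in> complex_roots p \<or> a \<in> complex_roots x" if "a \<in> complex_roots (p * x)"
      using that by (auto simp: complex_roots_def hom_distribs)
    then show ?case using factor prime_elem_imp_irreducible[of p]
      by (metis dvd_mult dvd_triv_left mult_eq_0_iff prime_imp_prime_elem)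
  qed auto
  then obtain Q where Q: "irreducible Q" "Q dvd P" "a \<in> complex_roots Q" using P a by force
  then obtain T where "P = Q * T" by auto
  then have "lead_coeff Q * lead_coeff T = 1" using P by (simp add: lead_coeff_mult)
  then have "lead_coeff Q = 1 \<or> lead_coeff Q = - 1" by (auto simp: zmult_eq_1_iff)
  then show ?thesis
  proof
    assume "lead_coeff Q = - 1"
    then show ?thesis using Q by (intro that[of "- Q"]) (auto simp: complex_roots_def hom_distribs)
  qed (use Q that in auto)
qed

lemma degree_pos_of_irreducible_monic:
  fixes Q :: "int poly"
  assumes "irreducible Q" "lead_coeff Q = 1"
  shows "degree Q > 0"
proof (rule ccontr)
  assume "\<not> degree Q > 0"
  then obtain c where "Q = [:c:]" by (auto elim: degree_eq_zeroE)
  then show False using assms by (simp add: irreducible_def)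
qed

text \<open>A multiple root would be shared with the derivative, so \<open>Q\<close> would divide
  its own nonzero derivative, which has smaller degree.\<close>

lemma rsquarefree_of_irreducible_monic:
  assumes irr: "irreducible Q" and monic: "lead_coeff Q = 1"
  shows "rsquarefree (of_int_poly Q :: complex poly)"
  unfolding rsquarefree_roots
proof safe
  fix a :: complex
  assume "poly (of_int_poly Q) a = 0" "poly (pderiv (of_int_poly Q)) a = 0"
  then have "Q dvd pderiv Q" using irr
    by (intro irreducible_dvd_if_common_root[of Q a])
       (auto simp: complex_roots_def of_int_hom.map_poly_pderiv[symmetric])
  then show False using not_dvd_pderiv[of Q] degree_pos_of_irreducible_monic[OF irr monic] by auto
qed

lemma of_int_poly_eq_prod_roots:
  assumes "irreducible Q" "lead_coeff Q = 1"
  shows "of_int_poly Q = (\<Prod>a\<in>complex_roots Q. [:-a, 1:])"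
  using complex_poly_decompose_rsquarefree[OF rsquarefree_of_irreducible_monic[OF assms]] assms
  by (simp add: complex_roots_def)

lemma finite_complex_roots: "P \<noteq> 0 \<Longrightarrow> finite (complex_roots P)"
  unfolding complex_roots_def by (intro poly_roots_finite) simp

lemma card_complex_roots:
  assumes "irreducible Q" "lead_coeff Q = 1"
  shows "card (complex_roots Q) = degree Q"
proof -
  have "degree Q = degree (of_int_poly Q :: complex poly)" by simp
  also have "\<dots> = card (complex_roots Q)"
    unfolding of_int_poly_eq_prod_roots[OF assms] by (subst degree_prod_eq_sum_degree) auto
  finally show ?thesis by simp
qed

subsection \<open>Norms are integers\<close>

text \<open>Multiplication by \<open>F\<close> on \<open>\<int>[x]/(Q)\<close> has an integer matrix \<open>A\<close> in the power basis, and the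
  Vandermonde matrix \<open>V\<close> of the roots diagonalises it over \<open>\<complex>\<close>, so the product below is \<open>det A\<close>.\<close>

lemma prod_poly_roots_in_Ints:
  fixes Q F :: "int poly"
  assumes monic: "lead_coeff Q = 1" and card: "card (complex_roots Q) = degree Q"
  shows "(\<Prod>a\<in>complex_roots Q. poly (of_int_poly F) a) \<in> \<int>"
proof -
  define m where "m = degree Q"
  have Q0: "Q \<noteq> 0" using monic by auto
  obtain as where as: "set as = complex_roots Q" "distinct as"
    using finite_distinct_list[OF finite_complex_roots[OF Q0]] by auto
  have len: "length as = m" using as card distinct_card[of as] by (simp add: m_def)
  \<comment> \<open>Since \<open>Q\<close> is monic, the pseudo-remainder is the true remainder of
    \<open>x^k F\<close> modulo \<open>Q\<close>; its coefficients form column \<open>k\<close> of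
    \<open>A\<close>.\<close>
  define r where "r k = pseudo_mod (monom 1 k * F) Q" for k
  have r_eval: "poly (of_int_poly (r k)) a = a ^ k * poly (of_int_poly F) a"
    if a: "a \<in> complex_roots Q" for a k
  proof -
    obtain q r' where qr: "pseudo_divmod (monom 1 k * F) Q = (q, r')" by fastforce
    then have "monom 1 k * F = Q * q + r k"
      using pseudo_divmod(1)[OF Q0 qr] monic by (simp add: r_def pseudo_mod_def)
    from arg_cong[OF this, of "\<lambda>p. poly (of_int_poly p) a"] a show ?thesis
      by (simp add: complex_roots_def hom_distribs poly_monom)
  qed
  have r_deg: "r k = 0 \<or> degree (r k) < m" for k
    unfolding r_def m_def by (rule pseudo_mod(2)[OF Q0])
  have r_sum: "(\<Sum>j<m. a ^ j * of_int (coeff (r k) j)) = poly (of_int_poly (r k)) a"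
    for a :: complex and k
  proof (cases "r k = 0")
    case False
    then have "(\<Sum>j<m. a ^ j * of_int (coeff (r k) j)) =
        (\<Sum>j\<le>degree (r k). a ^ j * of_int (coeff (r k) j))"
      using r_deg[of k] by (intro sum.mono_neutral_right) (auto simp: coeff_eq_0)
    then show ?thesis by (simp add: poly_altdef mult.commute)
  qed simp
  define V where "V = mat m m (\<lambda>(i, j). (as ! i) ^ j)"
  define A where "A = mat m m (\<lambda>(j, k). coeff (r k) j)"
  define D where "D = mat m m (\<lambda>(i, j). if i = j then poly (of_int_poly F) (as ! i) else 0)"
  have car: "V \<in> carrier_mat m m" "A \<in> carrier_mat m m" "D \<in> carrier_mat m m"
    by (auto simp: V_def A_def D_def)
  have "D * V = V * map_mat of_int A"
  proof (rule eq_matI)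
    fix i k assume "i < dim_row (V * map_mat complex_of_int A)"
      "k < dim_col (V * map_mat complex_of_int A)"
    then have ik: "i < m" "k < m" using car by auto
    then have root: "as ! i \<in> complex_roots Q" using as len by (metis nth_mem)
    have "(D * V) $$ (i, k) =
        (\<Sum>j<m. (if i = j then poly (of_int_poly F) (as ! i) else 0) * (as ! j) ^ k)"
      using ik by (simp add: V_def D_def scalar_prod_def atLeast0LessThan)
    also have "\<dots> = (as ! i) ^ k * poly (of_int_poly F) (as ! i)"
      using ik by (simp add: if_distrib[of "\<lambda>x. x * _"] cong: if_cong)
    also have "\<dots> = (V * map_mat of_int A) $$ (i, k)"
      using ik r_eval[OF root, of k] r_sum[of "as ! i" k]
      by (simp add: V_def A_def scalar_prod_def atLeast0LessThan)
    finally show "(D * V) $$ (i, k) = (V * map_mat of_int A) $$ (i, k)" .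
  qed (use car in auto)
  then have "det (D * V) = det (V * map_mat complex_of_int A)" by (rule arg_cong)
  moreover have "map_mat complex_of_int A \<in> carrier_mat m m" using car by simp
  ultimately have "det D * det V = det V * det (map_mat complex_of_int A)"
    using det_mult[OF car(3,1)] det_mult[OF car(1)] by metis
  \<comment> \<open>A kernel vector of \<open>V\<close> is the coefficient vector of a nonzero
    polynomial of degree below \<open>m\<close> with \<open>m\<close> distinct roots.\<close>
  moreover have "det V \<noteq> 0"
  proof
    assume "det V = 0"
    then obtain v where v: "v \<in> carrier_vec m" "v \<noteq> 0\<^sub>v m" "V *\<^sub>v v = 0\<^sub>v m"
      using det_0_iff_vec_prod_zero_field[OF car(1)] by auto
    define p where "p = (\<Sum>j<m. monom (v $ j) j)"
    have coeff_p: "coeff p j = (if j < m then v $ j else 0)" for j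
      by (simp add: p_def coeff_sum)
    have "p \<noteq> 0"
    proof
      assume "p = 0"
      then have "v $ j = 0" if "j < m" for j using coeff_p[of j] that by simp
      then show False using v by (auto intro!: eq_vecI)
    qed
    have root: "poly p a = 0" if a: "a \<in> set as" for a
    proof -
      obtain i where i: "i < m" "a = as ! i" using a unfolding in_set_conv_nth len by blast
      have "0 = (V *\<^sub>v v) $ i" using v i by simp
      also have "\<dots> = poly p a"
        using i v(1) by (simp add: V_def scalar_prod_def p_def poly_sum poly_monom mult.commute atLeast0LessThan)
      finally show ?thesis by simp
    qed
    have "m = card (set as)" using as len distinct_card by metis
    also have "\<dots> \<le> card {a. poly p a = 0}"
      using root poly_roots_finite[OF \<open>p \<noteq> 0\<close>] by (intro card_mono) auto
    also have "\<dots> \<le> degree p" using \<open>p \<noteq> 0\<close> by (rule card_poly_roots_bound)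
    finally have "coeff p (degree p) = 0" using coeff_p[of "degree p"] by simp
    then show False using \<open>p \<noteq> 0\<close> by simp
  qed
  ultimately have "det D = of_int (det A)" by (simp add: of_int_hom.hom_det)
  moreover have "det D = (\<Prod>a\<in>complex_roots Q. poly (of_int_poly F) a)"
  proof -
    have "det D = prod_list (diag_mat D)"
      using car by (intro det_upper_triangular[of D m]) (auto simp: D_def)
    also have "diag_mat D = map (poly (of_int_poly F)) as"
      by (rule nth_equalityI) (auto simp: diag_mat_def D_def len)
    finally show ?thesis using as by (metis prod.distinct_set_conv_list)
  qed
  ultimately show ?thesis by (metis Ints_of_int)
qed

lemma norm_ge_1_if_Ints:
  fixes z :: complex
  assumes "z \<in> \<int>" "z \<noteq> 0"
  shows "1 \<le> cmod z"
  using assms by (auto elim!: Ints_cases simp: norm_of_int)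

text \<open>The product of all \<open>a - b\<close> is the resultant of \<open>Q\<close> and
  \<open>R\<close>, here seen as the norm of \<open>R\<close>. It is an integer, and nonzero because
  no root is shared.\<close>

lemma prod_root_differences_ge_1:
  assumes Q: "irreducible Q" "lead_coeff Q = 1" and R: "irreducible R" "lead_coeff R = 1"
    and disj: "complex_roots Q \<inter> complex_roots R = {}"
  shows "1 \<le> (\<Prod>x\<in>complex_roots Q \<times> complex_roots R. cmod (fst x - snd x))"
proof -
  let ?A = "complex_roots Q" and ?B = "complex_roots R"
  have fin: "finite ?A" "finite ?B" using Q R by (auto intro!: finite_complex_roots)
  have R_eval: "poly (of_int_poly R) a = (\<Prod>b\<in>?B. a - b)" for a
    by (subst of_int_poly_eq_prod_roots[OF R]) (simp add: poly_prod)
  have "(\<Prod>a\<in>?A. \<Prod>b\<in>?B. a - b) \<in> \<int>"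
    using prod_poly_roots_in_Ints[OF Q(2) card_complex_roots[OF Q], of R] by (simp add: R_eval)
  moreover have "(\<Prod>a\<in>?A. \<Prod>b\<in>?B. a - b) \<noteq> 0" using fin disj by auto
  ultimately have "1 \<le> cmod (\<Prod>a\<in>?A. \<Prod>b\<in>?B. a - b)" by (rule norm_ge_1_if_Ints)
  then show ?thesis by (simp add: prod.cartesian_product case_prod_unfold prod_norm)
qed

text \<open>Up to sign this is the discriminant of \<open>Q\<close>, obtained as the norm of the
  derivative.\<close>

lemma prod_distinct_root_differences_ge_1:
  assumes Q: "irreducible Q" "lead_coeff Q = 1"
  shows "1 \<le> (\<Prod>x\<in>(SIGMA a:complex_roots Q. complex_roots Q - {a}). cmod (fst x - snd x))"
proof -
  let ?A = "complex_roots Q"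
  have fin: "finite ?A" using Q by (auto intro!: finite_complex_roots)
  have "poly (of_int_poly (pderiv Q)) a = (\<Prod>b\<in>?A - {a}. a - b)" if "a \<in> ?A" for a
  proof -
    have "poly (of_int_poly (pderiv Q)) a = (\<Sum>c\<in>?A. \<Prod>b\<in>?A - {c}. a - b)"
      unfolding of_int_hom.map_poly_pderiv of_int_poly_eq_prod_roots[OF Q] pderiv_prod
      by (simp add: poly_sum poly_prod pderiv_pCons)
    \<comment> \<open>In the product rule every summand with \<open>c\<close> other than
      \<open>a\<close> contains the factor \<open>a - a\<close>.\<close>
    also have "\<dots> = (\<Sum>c\<in>{a}. \<Prod>b\<in>?A - {c}. a - b)"
      using fin that by (intro sum.mono_neutral_right) auto
    finally show ?thesis by simp
  qed
  then have "(\<Prod>a\<in>?A. \<Prod>b\<in>?A - {a}. a - b) \<in> \<int>"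
    using prod_poly_roots_in_Ints[OF Q(2) card_complex_roots[OF Q], of "pderiv Q"] by simp
  moreover have "(\<Prod>a\<in>?A. \<Prod>b\<in>?A - {a}. a - b) \<noteq> 0" using fin by auto
  ultimately have "1 \<le> cmod (\<Prod>a\<in>?A. \<Prod>b\<in>?A - {a}. a - b)" by (rule norm_ge_1_if_Ints)
  then show ?thesis using fin by (simp add: prod.Sigma case_prod_unfold prod_norm)
qed

subsection \<open>Bounding products of root differences\<close>

text \<open>Grouping the pairs by first coordinate, \<open>w a\<close> occurs as often as row
  \<open>a\<close> has entries, hence at most \<open>e\<close> times.\<close>

lemma prod_fst_le_power:
  fixes w :: "'a \<Rightarrow> real"
  assumes fin: "finite A" "finite X" and X: "fst ` X \<subseteq> A"
    and w: "\<And>a. a \<in> A \<Longrightarrow> 1 \<le> w a" and row: "\<And>a. a \<in> A \<Longrightarrow> card (X `` {a}) \<le> e"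
  shows "(\<Prod>x\<in>X. w (fst x)) \<le> (\<Prod>a\<in>A. w a) ^ e"
proof -
  have "X `` {a} \<subseteq> snd ` X" for a by force
  then have rows: "finite (X `` {a})" for a using fin finite_subset by blast
  have "X = (SIGMA a:A. X `` {a})" using X by force
  then have "(\<Prod>x\<in>X. w (fst x)) = (\<Prod>(a, b)\<in>(SIGMA a:A. X `` {a}). w a)"
    by (simp add: case_prod_unfold)
  also have "\<dots> = (\<Prod>a\<in>A. w a ^ card (X `` {a}))"
    using fin rows by (subst prod.Sigma[symmetric]) auto
  also have "\<dots> \<le> (\<Prod>a\<in>A. w a ^ e)"
    using w row by (intro prod_mono conjI power_increasing zero_le_power) (auto intro: order_trans[of 0 1])
  finally show ?thesis by (simp add: prod_power_distrib)
qed

text \<open>The factor that one root contributes to the Mahler measure of a monic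
  polynomial.\<close>

definition mahler_weight :: "complex \<Rightarrow> real" where
  "mahler_weight z = max 1 (cmod z)"

lemma mahler_weight_ge_1: "1 \<le> mahler_weight z"
  by (simp add: mahler_weight_def)

lemma prod_mahler_weight_ge_1: "1 \<le> (\<Prod>x\<in>X. mahler_weight (f x))"
  by (intro prod_ge_1 mahler_weight_ge_1)

lemma cmod_diff_le: "cmod (a - b) \<le> 2 * (mahler_weight a * mahler_weight b)"
proof -
  have "cmod (a - b) \<le> mahler_weight a + mahler_weight b"
    using norm_triangle_ineq4[of a b] unfolding mahler_weight_def by linarith
  \<comment> \<open>Each weight is at most the product, since the other one is at least 1.\<close>
  also have "\<dots> \<le> mahler_weight a * mahler_weight b + mahler_weight a * mahler_weight b"
    using mahler_weight_ge_1[of a] mahler_weight_ge_1[of b]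
    by (intro add_mono) (simp_all add: mult_le_cancel_left1 mult_le_cancel_right1)
  finally show ?thesis by simp
qed

text \<open>Each pair costs a factor 2 and the weights of its two entries. The row and column bounds
  limit how often a given weight is charged.\<close>

lemma prod_differences_le:
  fixes X :: "(complex \<times> complex) set"
  assumes fin: "finite A" "finite B" and X: "X \<subseteq> A \<times> B"
    and row: "\<And>a. a \<in> A \<Longrightarrow> card (X `` {a}) \<le> e"
    and col: "\<And>b. b \<in> B \<Longrightarrow> card (X\<inverse> `` {b}) \<le> e"
  shows "(\<Prod>x\<in>X. cmod (fst x - snd x)) \<le>
    2 ^ card X * ((\<Prod>a\<in>A. mahler_weight a) * (\<Prod>b\<in>B. mahler_weight b)) ^ e"
proof -
  have finX: "finite X" using X fin by (meson finite_SigmaI finite_subset)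
  have fst: "(\<Prod>x\<in>X. mahler_weight (fst x)) \<le> (\<Prod>a\<in>A. mahler_weight a) ^ e"
    using fin finX X row by (intro prod_fst_le_power mahler_weight_ge_1) auto
  have "(\<Prod>x\<in>X. mahler_weight (snd x)) = (\<Prod>x\<in>X\<inverse>. mahler_weight (fst x))"
    by (rule prod.reindex_bij_witness[of _ prod.swap prod.swap]) auto
  also have "\<dots> \<le> (\<Prod>b\<in>B. mahler_weight b) ^ e"
    using fin finX X col by (intro prod_fst_le_power mahler_weight_ge_1) auto
  finally have snd: "(\<Prod>x\<in>X. mahler_weight (snd x)) \<le> (\<Prod>b\<in>B. mahler_weight b) ^ e" .
  have "(\<Prod>x\<in>X. cmod (fst x - snd x)) \<le>
      (\<Prod>x\<in>X. 2 * (mahler_weight (fst x) * mahler_weight (snd x)))"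
    by (intro prod_mono conjI cmod_diff_le) simp
  also have "\<dots> = 2 ^ card X *
      ((\<Prod>x\<in>X. mahler_weight (fst x)) * (\<Prod>x\<in>X. mahler_weight (snd x)))"
    by (simp add: prod.distrib)
  also have "\<dots> \<le> 2 ^ card X *
      ((\<Prod>a\<in>A. mahler_weight a) ^ e * (\<Prod>b\<in>B. mahler_weight b) ^ e)"
  proof (intro mult_left_mono mult_mono fst snd)
    show "0 \<le> (\<Prod>x\<in>X. mahler_weight (snd x))"
      using prod_mahler_weight_ge_1[of snd X] by simp
    show "0 \<le> (\<Prod>a\<in>A. mahler_weight a) ^ e"
      using prod_mahler_weight_ge_1[of "\<lambda>a. a" A] by simp
  qed simp
  finally show ?thesis by (simp add: power_mult_distrib)
qed

text \<open>The Mahler measure multiplies the weights over the list of roots with multiplicity.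
  Repetitions and roots outside \<open>S\<close> only add factors that are at least 1.\<close>

lemma prod_roots_le_mahler_measure:
  assumes monic: "lead_coeff P = 1" and S: "S \<subseteq> complex_roots P"
  shows "(\<Prod>a\<in>S. mahler_weight a) \<le> mahler_measure P"
proof -
  have le: "(\<Prod>a\<in>S. mahler_weight a) \<le> (\<Prod>a\<leftarrow>xs. mahler_weight a)" if "S \<subseteq> set xs" for xs S
    using that
  proof (induction xs arbitrary: S)
    case (Cons x xs)
    have fin: "finite S" using Cons.prems finite_subset by blast
    have "(\<Prod>a\<in>S. mahler_weight a) \<le> mahler_weight x * (\<Prod>a\<in>S - {x}. mahler_weight a)"
    proof (cases "x \<in> S")
      case True
      then show ?thesis using fin by (simp add: prod.remove)
    next
      case False
      then show ?thesis
        using mult_right_mono[OF mahler_weight_ge_1[of x], of "\<Prod>a\<in>S. mahler_weight a"]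
          prod_mahler_weight_ge_1[of "\<lambda>a. a" S] by simp
    qed
    also have "\<dots> \<le> mahler_weight x * (\<Prod>a\<leftarrow>xs. mahler_weight a)"
      using Cons.prems mahler_weight_ge_1[of x] by (intro mult_left_mono Cons.IH) auto
    finally show ?case by simp
  qed auto
  let ?p = "of_int_poly P :: complex poly"
  have "?p = (\<Prod>a\<leftarrow>complex_roots_complex ?p. [:-a, 1:])"
    using complex_roots(1)[of ?p] monic by simp
  then have "poly ?p z = poly (\<Prod>a\<leftarrow>complex_roots_complex ?p. [:-a, 1:]) z" for z
    by (rule arg_cong)
  then have "complex_roots P \<subseteq> set (complex_roots_complex ?p)"
    by (auto simp: complex_roots_def poly_prod_list prod_list_zero_iff)
  then show ?thesis using le[of S "complex_roots_complex ?p"] S monic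
    by (simp add: mahler_measure_def mahler_measure_poly_def mahler_weight_def)
qed

section \<open>Mahler measure against naive height\<close>

lemma abs_coeff_le_naive_height: "\<bar>coeff P i\<bar> \<le> naive_height P"
proof -
  have *: "\<bar>coeff P j\<bar> \<le> naive_height P" if "j \<le> degree P" for j
    unfolding naive_height_def using that by (intro Max_ge) auto
  show ?thesis using *[of i] *[of 0] by (cases "i \<le> degree P") (auto simp: coeff_eq_0)
qed

lemma mahler_measure_le_naive_height:
  assumes "P \<noteq> 0"
  shows "mahler_measure P \<le> (real (degree P) + 1) * real_of_int (naive_height P)"
proof -
  define H where "H = naive_height P"
  define n where "n = length (coeffs P)"
  have H0: "0 \<le> H" using abs_coeff_le_naive_height[of P 0] by (simp add: H_def)
  have n: "real n = real (degree P) + 1" using assms by (simp add: n_def length_coeffs)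
  have "(\<Sum>a\<leftarrow>coeffs P. a * a) \<le> (\<Sum>a\<leftarrow>coeffs P. H * H)"
  proof (rule sum_list_mono)
    fix a assume "a \<in> set (coeffs P)"
    then obtain i where "a = coeff P i" by (auto simp: in_set_conv_nth nth_coeffs_coeff length_coeffs)
    then have "\<bar>a\<bar> \<le> H" by (simp add: H_def abs_coeff_le_naive_height)
    then show "a * a \<le> H * H" using mult_mono[of "\<bar>a\<bar>" H "\<bar>a\<bar>" H] by simp
  qed
  also have "\<dots> = int n * (H * H)" by (simp add: sum_list_triv n_def)
  \<comment> \<open>Enlarging \<open>n\<close> to its square makes the bound a perfect square, so
    Landau's Euclidean norm is at most \<open>n * H\<close>.\<close>
  also have "\<dots> \<le> int n * int n * (H * H)"
  proof (intro mult_right_mono)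
    show "int n \<le> int n * int n" by (metis le_square of_nat_le_iff of_nat_mult)
  qed simp
  finally have "real_of_int (\<Sum>a\<leftarrow>coeffs P. a * a) \<le> real_of_int (int n * int n * (H * H))"
    by (simp only: of_int_le_iff)
  also have "\<dots> = (real n * real_of_int H)\<^sup>2" by (simp add: power2_eq_square)
  finally have "sqrt (real_of_int (\<Sum>a\<leftarrow>coeffs P. a * a)) \<le> real n * real_of_int H"
    by (intro real_le_lsqrt) (simp_all add: H0)
  then show ?thesis using Landau_inequality_mahler_measure[of P] n by (simp add: H_def)
qed

subsection \<open>Root separation\<close>

text \<open>A factor of full degree has a monic constant cofactor, so it is \<open>P\<close> itself;
  by Gauss's lemma \<open>P\<close> would then be irreducible over the rationals.\<close>

lemma degree_irreducible_factor_less: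
  assumes P: "P \<in> monic_reducible d" and Q: "irreducible Q" "lead_coeff Q = 1" "Q dvd P"
  shows "degree Q < d"
proof (rule ccontr)
  assume "\<not> degree Q < d"
  have P': "degree P = d" "lead_coeff P = 1" "\<not> irreducible (of_int_poly P :: rat poly)"
    using P by (auto simp: monic_reducible_def)
  obtain T where T: "P = Q * T" using Q(3) by auto
  have "T \<noteq> 0" "Q \<noteq> 0" using T P'(2) by auto
  then have "degree T = 0" using T P'(1) \<open>\<not> degree Q < d\<close> by (simp add: degree_mult_eq)
  moreover have "lead_coeff T = 1" using T P'(2) Q(2) by (simp add: lead_coeff_mult)
  ultimately have "T = 1" by (metis monic_degree_0)
  have pos: "degree Q > 0" using degree_pos_of_irreducible_monic[OF Q(1,2)] .
  have "irreducible\<^sub>d Q"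
  proof (rule irreducible\<^sub>dI[OF pos])
    fix q r assume qr: "degree q > 0" "degree q < degree Q" "degree r > 0" "degree r < degree Q"
      "Q = q * r"
    then have "q dvd 1 \<or> r dvd 1" using Q(1) irreducibleD by blast
    then show False using qr by (auto simp: poly_dvd_1)
  qed
  then have "irreducible\<^sub>d (of_int_poly Q :: rat poly)" by (rule irreducible\<^sub>d_int_rat)
  then show False using P'(3) T \<open>T = 1\<close> by simp
qed

lemma root_distance_ge:
  assumes P: "P \<in> monic_reducible d"
    and a: "a \<in> complex_roots P" and b: "b \<in> complex_roots P" and ab: "a \<noteq> b"
  shows "1 \<le> cmod (a - b) * (2 ^ d\<^sup>2 * mahler_measure P ^ (d - 2))"
proof -
  let ?w = mahler_weight and ?M = "mahler_measure P"
  have P': "degree P = d" "lead_coeff P = 1" "P \<noteq> 0" using P by (auto simp: monic_reducible_def)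
  obtain Q where Q: "irreducible Q" "lead_coeff Q = 1" "Q dvd P" "a \<in> complex_roots Q"
    using monic_irreducible_factor_with_root[OF P'(2) a] .
  obtain R where R: "irreducible R" "lead_coeff R = 1" "R dvd P" "b \<in> complex_roots R"
    using monic_irreducible_factor_with_root[OF P'(2) b] .
  define A B where "A = complex_roots Q" and "B = complex_roots R"
  have sub: "complex_roots S \<subseteq> complex_roots P" if "S dvd P" for S
    using that by (auto simp: complex_roots_def hom_distribs elim!: dvdE)
  have AB: "A \<subseteq> complex_roots P" "B \<subseteq> complex_roots P"
    using sub Q(3) R(3) by (auto simp: A_def B_def)
  have fin: "finite A" "finite B" using AB finite_complex_roots[OF P'(3)] finite_subset by auto
  have M: "1 \<le> ?M"
    using prod_roots_le_mahler_measure[OF P'(2), of "{}"] by simp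
  have prodA: "0 \<le> (\<Prod>a\<in>A. ?w a)" "(\<Prod>a\<in>A. ?w a) \<le> ?M"
    using prod_roots_le_mahler_measure[OF P'(2) AB(1)] prod_mahler_weight_ge_1[of "\<lambda>a. a" A] by auto
  show ?thesis
  proof (cases "b \<in> A")
    case True
    define n where "n = degree Q"
    have n: "card A = n" "n < d"
      using card_complex_roots[OF Q(1,2)] degree_irreducible_factor_less[OF P Q(1-3)]
      by (auto simp: A_def n_def)
    define Y where "Y = (SIGMA x:A. A - {x})"
    \<comment> \<open>Both orders of the close pair are removed, so the square of its distance
      splits off; a square root is taken at the end.\<close>
    define X where "X = Y - {(a, b), (b, a)}"
    have Y: "finite Y" "(a, b) \<in> Y" "(b, a) \<in> Y" "(a, b) \<noteq> (b, a)"
      using fin True Q(4) ab by (auto simp: Y_def A_def)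
    have X: "Y = insert (a, b) (insert (b, a) X)" "finite X" "(a, b) \<notin> X" "(b, a) \<notin> X"
      using Y by (auto simp: X_def)
    have "(\<Prod>x\<in>Y. cmod (fst x - snd x)) =
        cmod (a - b) * (cmod (b - a) * (\<Prod>x\<in>X. cmod (fst x - snd x)))"
      using ab by (simp add: X)
    then have "1 \<le> (cmod (a - b))\<^sup>2 * (\<Prod>x\<in>X. cmod (fst x - snd x))"
      using prod_distinct_root_differences_ge_1[OF Q(1,2)]
      by (simp add: Y_def A_def power2_eq_square norm_minus_commute mult.assoc)
    also have "(\<Prod>x\<in>X. cmod (fst x - snd x)) \<le>
        2 ^ card X * ((\<Prod>a\<in>A. ?w a) * (\<Prod>a\<in>A. ?w a)) ^ (n - 1)"
    proof (rule prod_differences_le[OF fin(1) fin(1)])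
      show "X \<subseteq> A \<times> A" by (auto simp: X_def Y_def)
    next
      fix c assume "c \<in> A"
      then have "card (A - {c}) = n - 1" using n fin by simp
      moreover have "X `` {c} \<subseteq> A - {c}" "X\<inverse> `` {c} \<subseteq> A - {c}" by (auto simp: X_def Y_def)
      ultimately show "card (X `` {c}) \<le> n - 1" "card (X\<inverse> `` {c}) \<le> n - 1"
        using card_mono[of "A - {c}"] fin by (metis finite_Diff)+
    qed
    also have "\<dots> \<le> 2 ^ d\<^sup>2 * (?M * ?M) ^ (d - 2)"
    proof (intro mult_mono)
      have "card X \<le> card (A \<times> A)" using fin by (intro card_mono) (auto simp: X_def Y_def)
      also have "\<dots> \<le> d\<^sup>2" using n by (simp add: card_cartesian_product power2_eq_square mult_mono)
      finally show "(2::real) ^ card X \<le> 2 ^ d\<^sup>2" by (intro power_increasing) auto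
      have "((\<Prod>a\<in>A. ?w a) * (\<Prod>a\<in>A. ?w a)) ^ (n - 1) \<le> (?M * ?M) ^ (n - 1)"
        using prodA by (intro power_mono mult_mono mult_nonneg_nonneg) auto
      also have "\<dots> \<le> (?M * ?M) ^ (d - 2)"
        using n M mult_mono[OF M M] by (intro power_increasing) auto
      finally show "((\<Prod>a\<in>A. ?w a) * (\<Prod>a\<in>A. ?w a)) ^ (n - 1) \<le> (?M * ?M) ^ (d - 2)" .
    qed (use prodA in auto)
    \<comment> \<open>The constant is squared only to make the right-hand side a perfect
      square.\<close>
    also have "\<dots> \<le> (2 ^ d\<^sup>2)\<^sup>2 * (?M * ?M) ^ (d - 2)"
      using M by (intro mult_right_mono self_le_power) auto
    also have "\<dots> = (2 ^ d\<^sup>2 * ?M ^ (d - 2))\<^sup>2"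
      by (simp add: power_mult_distrib power2_eq_square)
    finally have "1\<^sup>2 \<le> (cmod (a - b) * (2 ^ d\<^sup>2 * ?M ^ (d - 2)))\<^sup>2"
      by (simp add: power_mult_distrib mult_left_mono)
    then show ?thesis using M by (intro power2_le_imp_le[of 1]) auto
  next
    case False
    \<comment> \<open>A common root would make \<open>R\<close> divide \<open>Q\<close>, and then
      \<open>b\<close> would be a root of \<open>Q\<close>.\<close>
    have disj: "A \<inter> B = {}"
    proof (rule ccontr)
      assume "A \<inter> B \<noteq> {}"
      then obtain c where "c \<in> complex_roots Q" "c \<in> complex_roots R" by (auto simp: A_def B_def)
      then have "R dvd Q" using irreducible_dvd_if_common_root[OF R(1)] by blast
      then show False using R(4) False by (auto simp: A_def complex_roots_def hom_distribs elim!: dvdE)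
    qed
    define m n where "m = card A" and "n = card B"
    have "m + n = card (A \<union> B)" using disj fin by (simp add: card_Un_disjoint m_def n_def)
    also have "\<dots> \<le> card (complex_roots P)"
      using AB finite_complex_roots[OF P'(3)] by (intro card_mono) auto
    also have "\<dots> \<le> d" using card_poly_roots_bound[of "of_int_poly P :: complex poly"] P'(1,3)
      by (simp add: complex_roots_def)
    finally have mn: "m + n \<le> d" .
    have in_AB: "a \<in> A" "b \<in> B" using Q(4) R(4) by (auto simp: A_def B_def)
    define X where "X = A \<times> B - {(a, b)}"
    have X: "A \<times> B = insert (a, b) X" "finite X" "(a, b) \<notin> X"
      using in_AB fin by (auto simp: X_def)
    have "(\<Prod>x\<in>A \<times> B. cmod (fst x - snd x)) = cmod (a - b) * (\<Prod>x\<in>X. cmod (fst x - snd x))"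
      by (simp add: X)
    then have "1 \<le> cmod (a - b) * (\<Prod>x\<in>X. cmod (fst x - snd x))"
      using prod_root_differences_ge_1[OF Q(1,2) R(1,2)] disj by (simp add: A_def B_def)
    also have "(\<Prod>x\<in>X. cmod (fst x - snd x)) \<le>
        2 ^ card X * ((\<Prod>a\<in>A. ?w a) * (\<Prod>b\<in>B. ?w b)) ^ (d - 2)"
    proof (rule prod_differences_le[OF fin])
      show "X \<subseteq> A \<times> B" by (auto simp: X_def)
      \<comment> \<open>Row \<open>a\<close> has lost the pair \<open>(a, b)\<close> and keeps
        \<open>n - 1\<close> entries, with \<open>m\<close> at least 1. Any other row may have
        \<open>n\<close> entries, but then \<open>A\<close> contains both \<open>a\<close> and
        \<open>c\<close>, so \<open>m\<close> is at least 2. Both cases fit into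
        \<open>m + n \<le> d\<close>.\<close>
      show "card (X `` {c}) \<le> d - 2" if c: "c \<in> A" for c
      proof (cases "c = a")
        case True
        then have "X `` {c} = B - {b}" using c by (auto simp: X_def)
        then have "card (X `` {c}) = n - 1" using in_AB fin by (simp add: n_def)
        moreover have "m \<ge> 1" using in_AB fin card_gt_0_iff[of A] by (auto simp: m_def)
        ultimately show ?thesis using mn by simp
      next
        case False
        have "card {a, c} \<le> m" unfolding m_def using c in_AB fin by (intro card_mono) auto
        moreover have "X `` {c} \<subseteq> B" by (auto simp: X_def)
        then have "card (X `` {c}) \<le> n" unfolding n_def using fin by (intro card_mono)
        ultimately show ?thesis using mn False by simp
      qed
      show "card (X\<inverse> `` {c}) \<le> d - 2" if c: "c \<in> B" for c
      proof (cases "c = b")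
        case True
        then have "X\<inverse> `` {c} = A - {a}" using c by (auto simp: X_def)
        then have "card (X\<inverse> `` {c}) = m - 1" using in_AB fin by (simp add: m_def)
        moreover have "n \<ge> 1" using in_AB fin card_gt_0_iff[of B] by (auto simp: n_def)
        ultimately show ?thesis using mn by simp
      next
        case False
        have "card {b, c} \<le> n" unfolding n_def using c in_AB fin by (intro card_mono) auto
        moreover have "X\<inverse> `` {c} \<subseteq> A" by (auto simp: X_def)
        then have "card (X\<inverse> `` {c}) \<le> m" unfolding m_def using fin by (intro card_mono)
        ultimately show ?thesis using mn False by simp
      qed
    qed
    also have "\<dots> \<le> 2 ^ d\<^sup>2 * ?M ^ (d - 2)"
    proof (intro mult_mono)
      have "card X \<le> card (A \<times> B)" using fin by (intro card_mono) (auto simp: X_def)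
      also have "\<dots> \<le> d\<^sup>2"
        using mn by (simp add: card_cartesian_product power2_eq_square m_def n_def mult_mono)
      finally show "(2::real) ^ card X \<le> 2 ^ d\<^sup>2" by (intro power_increasing) auto
      \<comment> \<open>By disjointness the two products together cost a single Mahler measure, not
        its square.\<close>
      have "(\<Prod>a\<in>A. ?w a) * (\<Prod>b\<in>B. ?w b) = (\<Prod>c\<in>A \<union> B. ?w c)"
        using fin disj by (simp add: prod.union_disjoint)
      also have "\<dots> \<le> ?M" using AB by (intro prod_roots_le_mahler_measure[OF P'(2)]) auto
      finally show "((\<Prod>a\<in>A. ?w a) * (\<Prod>b\<in>B. ?w b)) ^ (d - 2) \<le> ?M ^ (d - 2)"
        using prodA prod_mahler_weight_ge_1[of "\<lambda>a. a" B]
        by (intro power_mono mult_nonneg_nonneg) auto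
      show "0 \<le> ((\<Prod>a\<in>A. ?w a) * (\<Prod>b\<in>B. ?w b)) ^ (d - 2)"
        using prodA prod_mahler_weight_ge_1[of "\<lambda>a. a" B]
        by (intro zero_le_power mult_nonneg_nonneg) auto
    qed auto
    finally show ?thesis by (simp add: mult_left_mono)
  qed
qed

section \<open>From root distances to the separation exponent and its limsup\<close>

lemma root_sep_attained:
  assumes "P \<in> monic_reducible d"
  obtains a b where "a \<in> complex_roots P" "b \<in> complex_roots P" "a \<noteq> b" "root_sep P = cmod (a - b)"
proof -
  let ?S = "{cmod (a - b) |a b. a \<in> complex_roots P \<and> b \<in> complex_roots P \<and> a \<noteq> b}"
  have fin: "finite (complex_roots P)"
    using assms by (intro finite_complex_roots) (auto simp: monic_reducible_def)
  have "?S \<subseteq> (\<lambda>(a, b). cmod (a - b)) ` (complex_roots P \<times> complex_roots P)" by auto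
  then have "finite ?S" using fin finite_subset by blast
  moreover have "?S \<noteq> {}" using assms by (auto simp: monic_reducible_def)
  ultimately have "root_sep P \<in> ?S" unfolding root_sep_def by (rule Min_in)
  then show ?thesis using that by blast
qed

text \<open>Insert the height bound for the Mahler measure into the distance bound and take
  logarithms. The error term has a numerator depending on \<open>d\<close> alone, so it vanishes as
  the height grows.\<close>

lemma sep_exponent_le:
  assumes d: "d \<ge> 2" and P: "P \<in> monic_reducible d" and H: "naive_height P \<ge> 2"
  shows "sep_exponent P \<le>
    real d - 2 + ln (2 ^ d\<^sup>2 * (real d + 1) ^ (d - 2)) / ln (real_of_int (naive_height P))"
proof -
  define h where "h = real_of_int (naive_height P)"
  define K where "K = 2 ^ d\<^sup>2 * (real d + 1) ^ (d - 2)"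
  obtain a b where ab: "a \<in> complex_roots P" "b \<in> complex_roots P" "a \<noteq> b"
    and sep: "root_sep P = cmod (a - b)"
    using root_sep_attained[OF P] .
  have P': "degree P = d" "P \<noteq> 0" using P by (auto simp: monic_reducible_def)
  have h: "h \<ge> 2" using H by (simp add: h_def)
  have K: "K > 0" by (simp add: K_def)
  have "1 \<le> cmod (a - b) * (2 ^ d\<^sup>2 * mahler_measure P ^ (d - 2))"
    using root_distance_ge[OF P ab] .
  also have "\<dots> \<le> cmod (a - b) * (2 ^ d\<^sup>2 * ((real d + 1) * h) ^ (d - 2))"
    using mahler_measure_le_naive_height[OF P'(2)] P'(1)
    by (intro mult_left_mono power_mono) (auto simp: h_def mahler_measure_ge_0)
  also have "\<dots> = cmod (a - b) * (K * h ^ (d - 2))"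
    by (simp add: K_def power_mult_distrib)
  finally have "0 \<le> ln (cmod (a - b) * (K * h ^ (d - 2)))" by simp
  also have "\<dots> = ln (cmod (a - b)) + (ln K + real (d - 2) * ln h)"
    using ab(3) K h by (simp add: ln_mult ln_realpow)
  finally have "- ln (root_sep P) \<le> (real d - 2) * ln h + ln K"
    using d by (simp add: sep of_nat_diff)
  moreover have "ln h > 0" using h by simp
  ultimately have "- ln (root_sep P) / ln h \<le> ((real d - 2) * ln h + ln K) / ln h"
    by (intro divide_right_mono) auto
  also have "\<dots> = real d - 2 + ln K / ln h" using \<open>ln h > 0\<close> by (simp add: add_divide_distrib)
  finally show ?thesis by (simp add: sep_exponent_def h_def K_def)
qed

theorem theorem1:
  fixes d :: nat
  assumes "d \<ge> 2"
  shows "e_r_star d \<le> ereal (real d - 2)"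
proof (rule ereal_le_epsilon2)
  fix \<epsilon> :: real assume \<epsilon>: "0 < \<epsilon>"
  define K where "K = 2 ^ d\<^sup>2 * (real d + 1) ^ (d - 2)"
  \<comment> \<open>From this height on the error term \<open>ln K / ln h\<close> is at most
    \<epsilon>; the 2 keeps the logarithm of the height positive.\<close>
  let ?H = "max 2 \<lceil>exp (ln K / \<epsilon>)\<rceil>"
  have bound: "sep_exponent P \<le> real d - 2 + \<epsilon>"
    if P: "P \<in> monic_reducible d" and H: "?H \<le> naive_height P" for P
  proof -
    have "exp (ln K / \<epsilon>) \<le> real_of_int (naive_height P)"
      using H by (simp add: ceiling_le_iff)
    then have "ln K / \<epsilon> \<le> ln (real_of_int (naive_height P))"
      using H by (simp add: ln_ge_iff)
    moreover have "ln (real_of_int (naive_height P)) > 0" using H by simp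
    ultimately have "ln K / ln (real_of_int (naive_height P)) \<le> \<epsilon>"
      using \<epsilon> by (simp add: field_simps)
    then show ?thesis using sep_exponent_le[OF assms P] H by (simp add: K_def)
  qed
  have "e_r_star d \<le> (SUP P\<in>{P \<in> monic_reducible d. naive_height P \<ge> ?H}. ereal (sep_exponent P))"
    unfolding e_r_star_eq_INF by (rule INF_lower) simp
  also have "\<dots> \<le> ereal (real d - 2 + \<epsilon>)"
    using bound by (intro SUP_least) auto
  finally show "e_r_star d \<le> ereal (real d - 2) + ereal \<epsilon>" by simp
qed

end
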